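(* Let $(X,\|\cdot\|)$ be a normed linear space over $\mathbb{K}$ ($\mathbb{K}=\mathbb{R}$ or $\mathbb{C}$), let $F_k:X\to\mathbb{K}$, $k\in\{1,\dots,m\}$, be continuous linear functionals on $X$, and let $x_i\in X\setminus\{0\}$, $i\in\{1,\dots,n\}$. Suppose there exist constants $r_k\ge 0$, $k\in\{1,\dots,m\}$, with $\sum_{k=1}^m r_k>0$ and $$\operatorname{Re}F_k(x_i)\ge r_k\|x_i\|\quad\text{for each } i\in\{1,\dots,n\},\ k\in\{1,\dots,m\}.$$ Let $p\ge 1$ be a real number. Then $$1\le \frac{\sum_{i=1}^n\|x_i\|}{\left\|\sum_{i=1}^n x_i\right\|}\le \frac{c_p}{\left(\sum_{k=1}^m r_k^p\right)^{1/p}}\le \left(\frac{\sum_{k=1}^m\|F_k\|^p}{\sum_{k=1}^m r_k^p}\right)^{1/p}.$$ Equality holds in the second inequality, i.e. $\frac{\sum_{i=1}^n\|x_i\|}{\|\sum_{i=1}^n x_i\|}= \frac{c_p}{(\sum_{k=1}^m r_k^p)^{1/p}}$, if and only if both $$\operatorname{Re}\left[F_k\left(\sum_{i=1}^n x_i\right)\right]=r_k\sum_{i=1}^n\|x_i\|\quad\text{for each }k\in\{1,\dots,m\}$$ and $$\sum_{k=1}^m\left[\operatorname{Re}F_k\left(\sum_{i=1}^n x_i\right)\right]^p=c_p^p\left\|\sum_{i=1}^n x_i\right\|^p.$$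
   Context: For the bounded linear functionals $F_1,\dots,F_m$ on $X$ and $p\in[1,\infty)$, $c_p:=\sup_{x\neq 0}\left[\frac{\sum_{k=1}^m|F_k(x)|^p}{\|x\|^p}\right]^{1/p}$. $\|F_k\|$ denotes the usual norm of the functional $F_k$. Here $m,n\ge 1$. *)

theory Defs
  imports "HOL-Analysis.Analysis"
begin

text \<open>The scalar field is a type that \<open>to_complex\<close> identifies, isometrically and as a real algebra,
  with the reals or with the whole complex plane.\<close>

class real_or_complex = real_normed_field +
  fixes to_complex :: "'a \<Rightarrow> complex"
  assumes to_complex_add: "to_complex (a + b) = to_complex a + to_complex b"
    and to_complex_mult: "to_complex (a * b) = to_complex a * to_complex b"
    and to_complex_scaleR: "to_complex (t *\<^sub>R a) = t *\<^sub>R to_complex a"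
    and norm_to_complex: "cmod (to_complex a) = norm a"
    and range_to_complex: "range to_complex = \<real> \<or> range to_complex = UNIV"

instantiation real :: real_or_complex
begin

definition "to_complex = complex_of_real"

instance
  by standard (auto simp: to_complex_real_def Reals_def scaleR_conv_of_real)

end

instantiation complex :: real_or_complex
begin

definition "to_complex = (\<lambda>z::complex. z)"

instance
  by standard (auto simp: to_complex_complex_def)

end

definition re :: "'k::real_or_complex \<Rightarrow> real"
  where "re a = Re (to_complex a)"

lemma re_real [simp]: "re (a::real) = a"
  by (simp add: re_def to_complex_real_def)

lemma re_complex [simp]: "re (z::complex) = Re z"
  by (simp add: re_def to_complex_complex_def)

text \<open>The library's \<open>real_normed_vector\<close> provides the norm and its topology; a space over the
  scalar field \<open>'k\<close> has in addition a scalar multiplication by \<open>'k\<close> that extends \<open>scaleR\<close>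
  and for which the norm is homogeneous.\<close>

locale normed_space_over = vector_space smul
  for smul :: "'k::real_or_complex \<Rightarrow> 'a::real_normed_vector \<Rightarrow> 'a" +
  assumes scale_of_real: "smul (of_real t) x = t *\<^sub>R x"
    and norm_scale: "norm (smul a x) = norm a * norm x"

lemma normed_space_over_scaleR:
  "normed_space_over (scaleR :: real \<Rightarrow> 'a::real_normed_vector \<Rightarrow> 'a)"
  by unfold_locales (simp_all add: scaleR_add_right scaleR_add_left)

lemma normed_space_over_mult:
  "normed_space_over ((*) :: 'k::real_or_complex \<Rightarrow> 'k \<Rightarrow> 'k)"
  by unfold_locales (simp_all add: distrib_left distrib_right mult.assoc norm_mult scaleR_conv_of_real)

definition continuous_linear_functional ::
  "('k::real_or_complex \<Rightarrow> 'a::real_normed_vector \<Rightarrow> 'a) \<Rightarrow> ('a \<Rightarrow> 'k) \<Rightarrow> bool"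
  where "continuous_linear_functional smul f \<longleftrightarrow>
    Vector_Spaces.linear smul (*) f \<and> continuous_on UNIV f"

text \<open>For bounded functionals on a nonzero space the supremum below is over a nonempty set that is
  bounded above, so it is the genuine one.\<close>

definition c_const ::
  "real \<Rightarrow> nat \<Rightarrow> (nat \<Rightarrow> 'a::real_normed_vector \<Rightarrow> 'k::real_or_complex) \<Rightarrow> real"
  where "c_const p m F =
    (SUP x\<in>{x. x \<noteq> 0}. ((\<Sum>k=1..m. norm (F k x) powr p) / norm x powr p) powr (1 / p))"

end

theory Submission imports Defs begin

text \<open>Write \<open>S\<close> for the sum of the vectors \<open>x i\<close> and \<open>N\<close> for the sum of their norms. Applying the
  additive function \<open>re \<circ> F k\<close> to \<open>S\<close> and adding the hypotheses gives \<open>r k * N \<le> re (F k S)\<close>, so for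
  each \<open>p \<ge> 1\<close> there is the chain
  \<open>(\<Sum>k. r k^p) * N^p \<le> (\<Sum>k. re (F k S)^p) \<le> (\<Sum>k. \<parallel>F k S\<parallel>^p) \<le> c^p * \<parallel>S\<parallel>^p\<close>, where \<open>c\<close> is \<open>c_const p m F\<close>.
  The last step is the definition of \<open>c\<close> as a supremum, which needs the quotients to be bounded:
  a continuous functional is bounded (\<open>continuous_linear_functional_imp_bounded_linear\<close>), and the
  operator norms give the bound \<open>(\<Sum> \<parallel>F k\<parallel>^p)^(1/p)\<close>. The same bound on the quotients is the third
  inequality. Taking \<open>p\<close>-th roots of the ends of the chain gives the second inequality.
  The first is the triangle inequality, with \<open>S \<noteq> 0\<close> because \<open>re (F k S) > 0\<close> for any \<open>k\<close> with \<open>r k > 0\<close>.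

  Equality in the second inequality means that the ends of the chain agree. Then all its members agree, and
  the first two can only agree term by term, because \<open>t \<mapsto> t^p\<close> is strictly increasing on the
  nonnegative reals; this gives the two stated conditions. Conversely, under these conditions the
  first two members both equal the last.\<close>

lemma re_add: "re (a + b) = re a + re b"
  by (simp add: re_def to_complex_add)

lemma re_zero: "re 0 = 0"
  using re_add[of 0 0] by simp

lemma re_sum: "re (\<Sum>i\<in>A. f i) = (\<Sum>i\<in>A. re (f i))"
  by (induction A rule: infinite_finite_induct) (simp_all add: re_zero re_add)

lemma re_le_norm: "re a \<le> norm a"
  using complex_Re_le_cmod[of "to_complex a"] by (simp add: re_def norm_to_complex)

text \<open>The operator norm and its lemmas concern real-linear maps, and a \<open>'k\<close>-linear functional is
  real-linear because \<open>smul\<close> extends \<open>scaleR\<close>. Boundedness is the usual rescaling argument: if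
  \<open>f\<close> is less than \<open>1\<close> in norm on the ball of radius \<open>d\<close>, then scaling \<open>x\<close> to length \<open>d / 2\<close> shows
  that \<open>2 / d\<close> is a bound.\<close>

lemma continuous_linear_functional_imp_bounded_linear:
  assumes X: "normed_space_over smul" and f: "continuous_linear_functional smul f"
  shows "bounded_linear f"
proof -
  interpret X: normed_space_over smul by (rule X)
  interpret f: Vector_Spaces.linear smul "(*)" f
    using f by (simp add: continuous_linear_functional_def)
  have scaleR: "f (t *\<^sub>R x) = t *\<^sub>R f x" for t x
    using f.scale[of "of_real t" x] by (simp add: X.scale_of_real scaleR_conv_of_real)
  have "isCont f 0"
    using f by (simp add: continuous_linear_functional_def continuous_on_eq_continuous_at)
  then have "\<exists>d>0. \<forall>z. dist z 0 < d \<longrightarrow> dist (f z) (f 0) < 1"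
    unfolding continuous_at_eps_delta using zero_less_one by blast
  then obtain d where d: "d > 0" "\<And>z. norm z < d \<Longrightarrow> norm (f z) < 1"
    by auto
  have "norm (f x) \<le> norm x * (2 / d)" for x
  proof (cases "x = 0")
    case False
    define t where "t = d / (2 * norm x)"
    have t: "t > 0" using False d by (simp add: t_def)
    have "norm (t *\<^sub>R x) < d" using False d by (simp add: t_def)
    then have "norm (f (t *\<^sub>R x)) < 1" by (rule d)
    then have "t * norm (f x) < 1" using t by (simp add: scaleR)
    then have "norm (f x) \<le> 1 / t" using t by (simp add: pos_le_divide_eq mult.commute)
    then show ?thesis by (simp add: t_def mult.commute)
  qed simp
  then show ?thesis
    by (intro bounded_linear_intro[where K = "2 / d"]) (simp_all add: f.add scaleR)
qed

lemma powr_quotient_le_onorm: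
  assumes F: "\<And>k. k \<in> {1..m} \<Longrightarrow> bounded_linear (F k)" and p: "p \<ge> 1" and x: "x \<noteq> 0"
  shows "((\<Sum>k=1..m. norm (F k x) powr p) / norm x powr p) powr (1 / p)
    \<le> (\<Sum>k=1..m. onorm (F k) powr p) powr (1 / p)"
proof (rule powr_mono2)
  have "(\<Sum>k=1..m. norm (F k x) powr p) \<le> (\<Sum>k=1..m. (onorm (F k) * norm x) powr p)"
    using F p by (intro sum_mono powr_mono2 onorm) auto
  also have "\<dots> = (\<Sum>k=1..m. onorm (F k) powr p) * norm x powr p"
    by (simp add: powr_mult sum_distrib_right)
  finally show "(\<Sum>k=1..m. norm (F k x) powr p) / norm x powr p \<le> (\<Sum>k=1..m. onorm (F k) powr p)"
    using x by (simp add: pos_divide_le_eq)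
qed (use p in \<open>auto intro!: divide_nonneg_nonneg sum_nonneg\<close>)

text \<open>The nonzero vector is there because the supremum of an empty set of reals is unspecified.\<close>

lemma c_const_le_onorm:
  fixes F :: "nat \<Rightarrow> 'a::real_normed_vector \<Rightarrow> 'k::real_or_complex"
  assumes "\<And>k. k \<in> {1..m} \<Longrightarrow> bounded_linear (F k)" and "p \<ge> 1" and "(x::'a) \<noteq> 0"
  shows "c_const p m F \<le> (\<Sum>k=1..m. onorm (F k) powr p) powr (1 / p)"
  unfolding c_const_def
  using assms by (intro cSUP_least powr_quotient_le_onorm) auto

lemma powr_quotient_le_c_const:
  assumes F: "\<And>k. k \<in> {1..m} \<Longrightarrow> bounded_linear (F k)" and p: "p \<ge> 1" and x: "x \<noteq> 0"
  shows "((\<Sum>k=1..m. norm (F k x) powr p) / norm x powr p) powr (1 / p) \<le> c_const p m F"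
  unfolding c_const_def
proof (rule cSUP_upper)
  show "bdd_above ((\<lambda>y. ((\<Sum>k=1..m. norm (F k y) powr p) / norm y powr p) powr (1 / p)) ` {y. y \<noteq> 0})"
    by (rule bdd_aboveI2, rule powr_quotient_le_onorm[OF F p]) simp_all
qed (use x in simp)

lemma c_const_nonneg:
  fixes F :: "nat \<Rightarrow> 'a::real_normed_vector \<Rightarrow> 'k::real_or_complex"
  assumes "\<And>k. k \<in> {1..m} \<Longrightarrow> bounded_linear (F k)" and "p \<ge> 1" and "(x::'a) \<noteq> 0"
  shows "c_const p m F \<ge> 0"
  using order_trans[OF powr_ge_zero powr_quotient_le_c_const[OF assms]] .

lemma sum_norm_powr_le_c_const:
  assumes F: "\<And>k. k \<in> {1..m} \<Longrightarrow> bounded_linear (F k)" and p: "p \<ge> 1" and x: "x \<noteq> 0"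
  shows "(\<Sum>k=1..m. norm (F k x) powr p) \<le> c_const p m F powr p * norm x powr p"
proof -
  let ?q = "(\<Sum>k=1..m. norm (F k x) powr p) / norm x powr p"
  have "?q \<ge> 0" by (intro divide_nonneg_nonneg sum_nonneg) auto
  moreover have "1 / p * p = 1" using p by simp
  ultimately have "?q = (?q powr (1 / p)) powr p" by (simp only: powr_powr powr_one)
  also have "\<dots> \<le> c_const p m F powr p"
    using p powr_quotient_le_c_const[OF F p x] by (intro powr_mono2) auto
  finally show ?thesis using x by (simp add: pos_divide_le_eq)
qed

lemma powr_le_cancel_iff_nonneg:
  fixes a b p :: real
  assumes "p > 0" "a \<ge> 0" "b \<ge> 0"
  shows "a powr p \<le> b powr p \<longleftrightarrow> a \<le> b"
  using assms powr_mono2[of p a b] powr_less_mono2[of p b a] by force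

lemma powr_eq_iff_nonneg:
  fixes a b p :: real
  assumes "p > 0" "a \<ge> 0" "b \<ge> 0"
  shows "a powr p = b powr p \<longleftrightarrow> a = b"
  using powr_le_cancel_iff_nonneg[OF assms] powr_le_cancel_iff_nonneg[OF assms(1,3,2)] by force

text \<open>This is how equality of the first two members of the chain is turned into the termwise
  condition: a sum of inequalities is an equality only if each of them is, and \<open>p\<close>-th powers of
  nonnegative numbers determine the numbers.\<close>

lemma sum_powr_eq_imp_eq:
  fixes a b :: "'i \<Rightarrow> real"
  assumes "finite A" and "p > 0" and "\<And>k. k \<in> A \<Longrightarrow> 0 \<le> a k" and "\<And>k. k \<in> A \<Longrightarrow> a k \<le> b k"
    and "(\<Sum>k\<in>A. a k powr p) = (\<Sum>k\<in>A. b k powr p)" and "k \<in> A"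
  shows "a k = b k"
proof -
  have "a k powr p = b k powr p"
    using assms by (intro sum_mono_inv[OF assms(5)] powr_mono2) auto
  then show ?thesis
    using assms(2) assms(3,4)[OF assms(6)] by (simp add: powr_eq_iff_nonneg)
qed

text \<open>The chain relates \<open>p\<close>-th powers, the theorem relates quotients; this translates between the two,
  for the inequality and for its equality case alike.\<close>

lemma quotient_compare_powr:
  fixes N s c R p :: real
  assumes "p > 0" "s > 0" "R > 0" "N \<ge> 0" "c \<ge> 0"
  shows "N / s \<le> c / R powr (1 / p) \<longleftrightarrow> R * N powr p \<le> c powr p * s powr p"
    and "N / s = c / R powr (1 / p) \<longleftrightarrow> R * N powr p = c powr p * s powr p"
proof -
  define D where "D = R powr (1 / p)"
  have D: "D > 0" "D powr p = R" using assms by (simp_all add: D_def powr_powr)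
  have *: "R * N powr p = (D * N) powr p" "c powr p * s powr p = (c * s) powr p"
    using D by (simp_all add: powr_mult)
  have "N / s \<le> c / D \<longleftrightarrow> D * N \<le> c * s" "N / s = c / D \<longleftrightarrow> D * N = c * s"
    using D assms by (simp_all add: field_simps)
  then show "N / s \<le> c / R powr (1 / p) \<longleftrightarrow> R * N powr p \<le> c powr p * s powr p"
    "N / s = c / R powr (1 / p) \<longleftrightarrow> R * N powr p = c powr p * s powr p"
    unfolding * D_def[symmetric]
    using D assms by (simp_all add: powr_le_cancel_iff_nonneg powr_eq_iff_nonneg)
qed

theorem theorem9:
  fixes smul :: "'k::real_or_complex \<Rightarrow> 'a::real_normed_vector \<Rightarrow> 'a"
    and F :: "nat \<Rightarrow> 'a \<Rightarrow> 'k"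
    and x :: "nat \<Rightarrow> 'a"
    and r :: "nat \<Rightarrow> real"
    and m n :: nat
    and p :: real
  assumes X: "normed_space_over smul"
    and m: "m \<ge> 1" and n: "n \<ge> 1"
    and F: "\<And>k. k \<in> {1..m} \<Longrightarrow> continuous_linear_functional smul (F k)"
    and x: "\<And>i. i \<in> {1..n} \<Longrightarrow> x i \<noteq> 0"
    and r: "\<And>k. k \<in> {1..m} \<Longrightarrow> r k \<ge> 0" and r_pos: "(\<Sum>k=1..m. r k) > 0"
    and re_ge: "\<And>i k. i \<in> {1..n} \<Longrightarrow> k \<in> {1..m} \<Longrightarrow> re (F k (x i)) \<ge> r k * norm (x i)"
    and p: "p \<ge> 1"
  shows "1 \<le> (\<Sum>i=1..n. norm (x i)) / norm (\<Sum>i=1..n. x i)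
    \<and> (\<Sum>i=1..n. norm (x i)) / norm (\<Sum>i=1..n. x i)
        \<le> c_const p m F / (\<Sum>k=1..m. r k powr p) powr (1 / p)
    \<and> c_const p m F / (\<Sum>k=1..m. r k powr p) powr (1 / p)
        \<le> ((\<Sum>k=1..m. onorm (F k) powr p) / (\<Sum>k=1..m. r k powr p)) powr (1 / p)
    \<and> ((\<Sum>i=1..n. norm (x i)) / norm (\<Sum>i=1..n. x i)
          = c_const p m F / (\<Sum>k=1..m. r k powr p) powr (1 / p)
        \<longleftrightarrow> (\<forall>k\<in>{1..m}. re (F k (\<Sum>i=1..n. x i)) = r k * (\<Sum>i=1..n. norm (x i)))
          \<and> (\<Sum>k=1..m. re (F k (\<Sum>i=1..n. x i)) powr p)
              = c_const p m F powr p * norm (\<Sum>i=1..n. x i) powr p)"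
proof -
  define S where "S = (\<Sum>i=1..n. x i)"
  define N where "N = (\<Sum>i=1..n. norm (x i))"
  define R where "R = (\<Sum>k=1..m. r k powr p)"
  define c where "c = c_const p m F"
  have bl: "bounded_linear (F k)" if "k \<in> {1..m}" for k
    using X F[OF that] by (rule continuous_linear_functional_imp_bounded_linear)
  have N_pos: "N > 0"
    unfolding N_def using n x by (intro sum_pos) auto
  have r_N_le: "r k * N \<le> re (F k S)" if k: "k \<in> {1..m}" for k
  proof -
    have "F k S = (\<Sum>i=1..n. F k (x i))"
      unfolding S_def by (rule linear_sum[OF bounded_linear.linear[OF bl[OF k]]])
    then show ?thesis
      unfolding N_def by (simp add: re_sum sum_distrib_left) (intro sum_mono re_ge k; simp)
  qed
  obtain j where j: "j \<in> {1..m}" "r j > 0"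
    using r_pos sum_nonpos[of "{1..m}" r] by (meson not_less)
  have S_nonzero: "S \<noteq> 0"
  proof
    assume "S = 0"
    then have "F j S = 0" using linear_0[OF bounded_linear.linear[OF bl[OF j(1)]]] by simp
    then show False using r_N_le[OF j(1)] mult_pos_pos[OF j(2) N_pos] by (simp add: re_zero)
  qed
  have R_pos: "R > 0"
    unfolding R_def using j by (intro sum_pos2[of _ j]) auto
  have c_nonneg: "c \<ge> 0"
    unfolding c_def using bl p S_nonzero by (rule c_const_nonneg)
  have rN_nonneg: "0 \<le> r k * N" if "k \<in> {1..m}" for k
    using r[OF that] N_pos by simp
  have chain1_eq: "R * N powr p = (\<Sum>k=1..m. (r k * N) powr p)"
    by (simp add: R_def powr_mult sum_distrib_right)
  have chain1: "R * N powr p \<le> (\<Sum>k=1..m. re (F k S) powr p)"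
    unfolding chain1_eq using p rN_nonneg r_N_le by (intro sum_mono powr_mono2) auto
  have "(\<Sum>k=1..m. re (F k S) powr p) \<le> (\<Sum>k=1..m. norm (F k S) powr p)"
    using p order_trans[OF rN_nonneg r_N_le] by (intro sum_mono powr_mono2 re_le_norm) auto
  also have "\<dots> \<le> c powr p * norm S powr p"
    unfolding c_def using bl p S_nonzero by (rule sum_norm_powr_le_c_const)
  finally have chain2: "(\<Sum>k=1..m. re (F k S) powr p) \<le> c powr p * norm S powr p" .
  have compare: "N / norm S \<le> c / R powr (1 / p) \<longleftrightarrow> R * N powr p \<le> c powr p * norm S powr p"
    "N / norm S = c / R powr (1 / p) \<longleftrightarrow> R * N powr p = c powr p * norm S powr p"
    using p S_nonzero R_pos N_pos c_nonneg
      quotient_compare_powr[where p = p and s = "norm S" and R = R and N = N and c = c] by simp_all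

  have "1 \<le> N / norm S"
    using S_nonzero norm_sum[of x "{1..n}"] by (simp add: S_def N_def)
  moreover have "N / norm S \<le> c / R powr (1 / p)"
    using compare(1) chain1 chain2 by linarith
  moreover have "c / R powr (1 / p) \<le> ((\<Sum>k=1..m. onorm (F k) powr p) / R) powr (1 / p)"
    using c_const_le_onorm[OF bl p S_nonzero] R_pos
    by (simp add: c_def powr_divide divide_right_mono)
  moreover have "N / norm S = c / R powr (1 / p) \<longleftrightarrow>
    (\<forall>k\<in>{1..m}. re (F k S) = r k * N) \<and> (\<Sum>k=1..m. re (F k S) powr p) = c powr p * norm S powr p"
  proof (intro iffI conjI ballI)
    assume "N / norm S = c / R powr (1 / p)"
    then have ends: "R * N powr p = c powr p * norm S powr p" using compare(2) by simp
    then show "(\<Sum>k=1..m. re (F k S) powr p) = c powr p * norm S powr p"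
      using chain1 chain2 by linarith
    then have "(\<Sum>k=1..m. (r k * N) powr p) = (\<Sum>k=1..m. re (F k S) powr p)"
      using ends chain1_eq by simp
    then show "re (F k S) = r k * N" if "k \<in> {1..m}" for k
      using sum_powr_eq_imp_eq[of "{1..m}" p "\<lambda>k. r k * N" "\<lambda>k. re (F k S)" k]
        p rN_nonneg r_N_le that by simp
  next
    assume *: "(\<forall>k\<in>{1..m}. re (F k S) = r k * N) \<and>
      (\<Sum>k=1..m. re (F k S) powr p) = c powr p * norm S powr p"
    then have "R * N powr p = (\<Sum>k=1..m. re (F k S) powr p)"
      unfolding chain1_eq by (intro sum.cong) simp_all
    with * have "R * N powr p = c powr p * norm S powr p" by linarith
    then show "N / norm S = c / R powr (1 / p)" using compare(2) by simp
  qed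
  ultimately show ?thesis unfolding S_def N_def R_def c_def by blast
qed

end
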